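(* For any real-valued $h\in\mathcal{S}(\mathbb{R}^2)$ there exists $u=(u_1,u_2):\mathbb{R}^2\to\mathbb{R}^2$ with $u\in C^1(\mathbb{R}^2)$ such that $$\det(\nabla u(x,y))=h(x,y)\quad\text{for all }(x,y)\in\mathbb{R}^2,$$ and furthermore $\nabla u\in L^\infty(\mathbb{R}^2)$.
   Context: $\mathcal{S}(\mathbb{R}^2)$ denotes the Schwartz space of rapidly decreasing smooth functions on $\mathbb{R}^2$. For a map $u=(u_1,u_2):\mathbb{R}^2\to\mathbb{R}^2$, $\nabla u$ is the $2\times 2$ Jacobian matrix of partial derivatives, so $\det(\nabla u)=\partial_x u_1\,\partial_y u_2-\partial_y u_1\,\partial_x u_2$. *)

theory Defs
  imports "HOL-Analysis.Analysis"
begin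

definition partial_deriv ::
    "'n::finite \<Rightarrow> (real ^ 'n \<Rightarrow> 'b::real_normed_vector) \<Rightarrow> (real ^ 'n \<Rightarrow> 'b)" where
  "partial_deriv i f = (\<lambda>p. frechet_derivative f (at p) (axis i 1))"

text \<open>Total differentiability is demanded at each order because \<^const>\<open>frechet_derivative\<close>
  has an unspecified value where the derivative does not exist. As continuous partial
  derivatives imply total differentiability, this is the usual class \<open>C\<^sup>k\<close>.\<close>

fun C_k :: "nat \<Rightarrow> (real ^ 'n::finite \<Rightarrow> 'b::real_normed_vector) \<Rightarrow> bool" where
  "C_k 0 f \<longleftrightarrow> continuous_on UNIV f"
| "C_k (Suc k) f \<longleftrightarrow> f differentiable_on UNIV \<and> (\<forall>i. C_k k (partial_deriv i f))"

text \<open>In \<open>sup \<bar>x\<^sup>\<alpha> \<partial>\<^sup>\<beta> f\<bar> < \<infinity>\<close> the multi-index \<open>\<alpha>\<close> is a function on the coordinates, while the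
  derivative \<open>\<partial>\<^sup>\<beta>\<close> is encoded by the list \<open>is\<close> of the directions of differentiation. For smooth
  \<open>f\<close> only the multiplicities in \<open>is\<close> matter, so these are exactly the derivatives \<open>\<partial>\<^sup>\<beta>\<close>.\<close>

definition schwartz :: "(real ^ 'n::finite \<Rightarrow> 'b::real_normed_vector) set" where
  "schwartz = {f. (\<forall>k. C_k k f) \<and>
     (\<forall>(\<alpha> :: 'n \<Rightarrow> nat) is.
        bounded (range (\<lambda>p. (\<Prod>i\<in>UNIV. (p $ i) ^ \<alpha> i) *\<^sub>R fold partial_deriv is f p)))}"

definition L_infinity :: "('a::euclidean_space \<Rightarrow> 'b::real_normed_vector) set" where
  "L_infinity = {f. f \<in> borel_measurable lebesgue \<and> (\<exists>C. AE p in lebesgue. norm (f p) \<le> C)}"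

end

theory Submission
  imports Defs
begin

text \<open>Take \<open>u(x, y) = (x, \<integral>\<^sub>0\<^sup>y h(x, t) dt)\<close>. Its Jacobian matrix is lower triangular with diagonal
  entries \<open>1\<close> and \<open>h\<close>, and the remaining entry \<open>\<integral>\<^sub>0\<^sup>y \<partial>\<^sub>x h(x, t) dt\<close> is bounded because
  \<open>\<bar>\<partial>\<^sub>x h(x, t)\<bar> \<le> C / (1 + t\<^sup>2)\<close>.\<close>

text \<open>Written in the standard basis, so that linearity in the point and affinity in the factor
  are visible and the derivative and continuity rules apply term by term.\<close>

definition squeeze :: "real \<Rightarrow> real ^ 2 \<Rightarrow> real ^ 2" where
  "squeeze s p = (p $ 1) *\<^sub>R axis 1 1 + (s * p $ 2) *\<^sub>R axis 2 1"

text \<open>The substitution \<open>t = s y\<close> turns \<open>\<integral>\<^sub>0\<^sup>y f(x, t) dt\<close> into an integral over a fixed interval,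
  which avoids the oriented integral for \<open>y < 0\<close>.\<close>

definition vertical_integral :: "(real ^ 2 \<Rightarrow> real) \<Rightarrow> real ^ 2 \<Rightarrow> real" where
  "vertical_integral f p = p $ 2 * integral {0..1} (\<lambda>s. f (squeeze s p))"

lemma squeeze_nth [simp]: "squeeze s p $ 1 = p $ 1" "squeeze s p $ 2 = s * p $ 2"
  by (simp_all add: squeeze_def axis_def)

lemma squeeze_1 [simp]: "squeeze 1 p = p"
  by (simp add: vec_eq_iff forall_2)

lemma vec2_decomp: "v = (v :: real ^ 2) $ 1 *\<^sub>R axis 1 1 + v $ 2 *\<^sub>R axis 2 1"
  by (simp add: vec_eq_iff forall_2 axis_def)

lemma continuous_on_squeeze [continuous_intros]:
  assumes "continuous_on S f" "continuous_on S g"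
  shows "continuous_on S (\<lambda>x. squeeze (f x) (g x))"
  unfolding squeeze_def by (intro continuous_intros assms)

lemma vec_nth_has_derivative [derivative_intros]:
  assumes "(f has_derivative f') F"
  shows "((\<lambda>x. f x $ i) has_derivative (\<lambda>v. f' v $ i)) F"
  using bounded_linear.has_derivative[OF bounded_linear_vec_nth assms] .

lemma squeeze_has_derivative_point: "(squeeze s has_derivative squeeze s) (at p within S)"
  unfolding squeeze_def[abs_def] by (auto intro!: derivative_eq_intros)

lemma squeeze_has_derivative_factor:
  "((\<lambda>s. squeeze s p) has_derivative (\<lambda>r. (r * p $ 2) *\<^sub>R axis 2 1)) (at s within S)"
  unfolding squeeze_def by (auto intro!: derivative_eq_intros)

lemma C_1_D:
  assumes "C_k 1 f"
  shows "f differentiable (at p)" "continuous_on UNIV (partial_deriv i f)"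
  using assms by (auto simp: differentiable_on_def)

lemma C_1_has_derivative:
  fixes f :: "real ^ 2 \<Rightarrow> real"
  assumes "C_k 1 f"
  shows "(f has_derivative (\<lambda>v. v $ 1 * partial_deriv 1 f p + v $ 2 * partial_deriv 2 f p)) (at p)"
proof -
  have D: "(f has_derivative frechet_derivative f (at p)) (at p)"
    using C_1_D(1)[OF assms] frechet_derivative_works by blast
  then interpret bounded_linear "frechet_derivative f (at p)"
    by (rule has_derivative_bounded_linear)
  have "frechet_derivative f (at p) v = v $ 1 * partial_deriv 1 f p + v $ 2 * partial_deriv 2 f p" for v
    by (subst vec2_decomp[of v]) (simp add: add scaleR partial_deriv_def)
  then show ?thesis using D by presburger
qed

lemma C_1_continuous:
  assumes "C_k 1 f"
  shows "continuous_on UNIV f"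
  using assms by (simp add: differentiable_imp_continuous_on)

text \<open>Differentiation under the integral sign: for \<open>f\<close> of class C^1 the
  derivative of the integrand is jointly continuous in \<open>p\<close> and \<open>s\<close>. The
  weight \<open>s\<close> in the second integral comes from the chain rule, as
  \<open>squeeze s\<close> scales the second coordinate by \<open>s\<close>.\<close>

lemma integral_squeeze_has_derivative:
  fixes f :: "real ^ 2 \<Rightarrow> real"
  assumes f: "C_k 1 f"
  shows "((\<lambda>p. integral {0..1} (\<lambda>s. f (squeeze s p))) has_derivative
     (\<lambda>v. v $ 1 * integral {0..1} (\<lambda>s. partial_deriv 1 f (squeeze s p)) +
          v $ 2 * integral {0..1} (\<lambda>s. s * partial_deriv 2 f (squeeze s p)))) (at p)"
proof -
  note cont [continuous_intros] = continuous_on_compose2[OF C_1_continuous[OF f]]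
    continuous_on_compose2[OF C_1_D(2)[OF f]]
  \<comment> \<open>The Leibniz rule integrates the derivative as an element of the space of bounded
    linear functionals; \<open>B i\<close> is the i-th coordinate functional there.\<close>
  define B :: "2 \<Rightarrow> (real ^ 2) \<Rightarrow>\<^sub>L real" where "B i = blinfun_inner_left (axis i 1)" for i
  have B: "blinfun_apply (B i) v = v $ i" for i v
    by (simp add: B_def inner_axis inner_commute)
  define F where "F p s = partial_deriv 1 f (squeeze s p) *\<^sub>R B 1 + (s * partial_deriv 2 f (squeeze s p)) *\<^sub>R B 2" for p s
  have "((\<lambda>p. integral (cbox 0 1) (\<lambda>s. f (squeeze s p))) has_derivative integral (cbox 0 1) (F p)) (at p within UNIV)"
  proof (rule leibniz_rule)
    fix q :: "real ^ 2" and s :: real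
    show "((\<lambda>q. f (squeeze s q)) has_derivative blinfun_apply (F q s)) (at q within UNIV)"
      by (rule has_derivative_eq_rhs[OF has_derivative_compose[OF squeeze_has_derivative_point C_1_has_derivative[OF f]]])
         (simp add: F_def B plus_blinfun.rep_eq scaleR_blinfun.rep_eq fun_eq_iff)
    show "(\<lambda>s. f (squeeze s q)) integrable_on cbox 0 1"
      by (intro integrable_continuous continuous_intros) auto
    show "continuous_on (UNIV \<times> cbox 0 1) (\<lambda>(p, s). F p s)"
      unfolding F_def split_beta by (intro continuous_intros) auto
  qed auto
  \<comment> \<open>The functionals \<open>B 1\<close> and \<open>B 2\<close> do not depend on
    \<open>s\<close>, so integrating \<open>F p\<close> reduces to integrating its two scalar
    coefficients.\<close>
  moreover have "integral (cbox 0 1) (F p) =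
      integral {0..1} (\<lambda>s. partial_deriv 1 f (squeeze s p)) *\<^sub>R B 1 +
      integral {0..1} (\<lambda>s. s * partial_deriv 2 f (squeeze s p)) *\<^sub>R B 2"
  proof -
    have "((\<lambda>s. F p s) has_integral integral {0..1} (\<lambda>s. partial_deriv 1 f (squeeze s p)) *\<^sub>R B 1 +
      integral {0..1} (\<lambda>s. s * partial_deriv 2 f (squeeze s p)) *\<^sub>R B 2) {0..1}"
      unfolding F_def
      by (intro has_integral_add has_integral_scaleR_left integrable_integral
          integrable_continuous_interval continuous_intros) auto
    then show ?thesis by (simp add: integral_unique)
  qed
  ultimately show ?thesis
    by (simp add: B plus_blinfun.rep_eq scaleR_blinfun.rep_eq mult.commute)
qed

text \<open>The product rule gives \<open>?I + p $ 2 * ?K\<close> as the coefficient of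
  \<open>v $ 2\<close>. Computing the integral over \<open>s\<close> of the derivative of
  \<open>s * f (squeeze s p)\<close> in two ways shows that this is \<open>f p\<close>.\<close>

lemma vertical_integral_has_derivative:
  assumes f: "C_k 1 f"
  shows "(vertical_integral f has_derivative
     (\<lambda>v. v $ 1 * vertical_integral (partial_deriv 1 f) p + v $ 2 * f p)) (at p)"
proof -
  note cont [continuous_intros] = continuous_on_compose2[OF C_1_continuous[OF f]]
    continuous_on_compose2[OF C_1_D(2)[OF f]]
  let ?I = "integral {0..1} (\<lambda>s. f (squeeze s p))"
  let ?K = "integral {0..1} (\<lambda>s. s * partial_deriv 2 f (squeeze s p))"
  \<comment> \<open>The primitive \<open>s * f (squeeze s p)\<close> vanishes at 0 and equals
    \<open>f p\<close> at 1.\<close>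
  have "((\<lambda>s. f (squeeze s p) + p $ 2 * (s * partial_deriv 2 f (squeeze s p))) has_integral
      1 * f (squeeze 1 p) - 0 * f (squeeze 0 p)) {0..1}"
  proof (rule fundamental_theorem_of_calculus)
    fix s :: real
    have "((\<lambda>s. f (squeeze s p)) has_derivative (\<lambda>r. r * p $ 2 * partial_deriv 2 f (squeeze s p))) (at s within {0..1})"
      by (rule has_derivative_eq_rhs[OF has_derivative_compose[OF squeeze_has_derivative_factor C_1_has_derivative[OF f]]])
         (simp add: axis_def fun_eq_iff)
    then show "((\<lambda>s. s * f (squeeze s p)) has_vector_derivative
        f (squeeze s p) + p $ 2 * (s * partial_deriv 2 f (squeeze s p))) (at s within {0..1})"
      unfolding has_vector_derivative_def
      by (auto intro!: derivative_eq_intros simp: algebra_simps)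
  qed auto
  moreover have "((\<lambda>s. f (squeeze s p) + p $ 2 * (s * partial_deriv 2 f (squeeze s p))) has_integral ?I + p $ 2 * ?K) {0..1}"
    by (intro has_integral_add has_integral_mult_right integrable_integral
        integrable_continuous_interval continuous_intros) auto
  ultimately have "f p = ?I + p $ 2 * ?K"
    by (simp add: has_integral_unique)
  then show ?thesis
    unfolding vertical_integral_def[abs_def]
    by (auto intro!: derivative_eq_intros integral_squeeze_has_derivative[OF f]
        simp: fun_eq_iff algebra_simps)
qed

lemma vertical_integral_continuous:
  assumes "continuous_on UNIV f"
  shows "continuous_on UNIV (vertical_integral f)"
proof -
  have "continuous_on UNIV (\<lambda>p. integral (cbox 0 1) (\<lambda>s. f (squeeze s p)))"
    by (intro integral_continuous_on_param) (auto simp: split_beta intro!: continuous_on_compose2[OF assms] continuous_intros)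
  then show ?thesis
    unfolding vertical_integral_def[abs_def] by (auto intro!: continuous_intros)
qed

text \<open>The decay of \<open>f\<close> in the second coordinate dominates the rescaled integrand
  by a multiple of the derivative of an arctangent, whose increment is at most pi/2 however large
  \<open>p $ 2\<close> is.\<close>

lemma vertical_integral_bounded:
  assumes cont: "continuous_on UNIV f"
    and bound: "\<And>p. \<bar>f p\<bar> * (1 + (p $ 2)\<^sup>2) \<le> C"
  shows "\<bar>vertical_integral f p\<bar> \<le> C * pi / 2"
proof -
  let ?y = "p $ 2"
  have "0 \<le> C"
    using bound[of 0] by (simp add: order_trans[OF abs_ge_zero])
  \<comment> \<open>The primitive is \<open>C * arctan (\<bar>?y\<bar> * s)\<close>. Using the
    absolute value covers both signs of \<open>?y\<close>, and for \<open>?y = 0\<close> both sides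
    vanish.\<close>
  have int: "((\<lambda>s. C * (\<bar>?y\<bar> / (1 + (\<bar>?y\<bar> * s)\<^sup>2))) has_integral C * (arctan (\<bar>?y\<bar> * 1) - arctan (\<bar>?y\<bar> * 0))) {0..1}"
    by (intro has_integral_mult_right fundamental_theorem_of_calculus)
       (auto simp flip: has_real_derivative_iff_has_vector_derivative intro!: derivative_eq_intros
             simp: divide_simps)
  have "\<bar>vertical_integral f p\<bar> = norm (integral {0..1} (\<lambda>s. ?y * f (squeeze s p)))"
    by (simp add: vertical_integral_def)
  also have "\<dots> \<le> integral {0..1} (\<lambda>s. C * (\<bar>?y\<bar> / (1 + (\<bar>?y\<bar> * s)\<^sup>2)))"
  proof (rule integral_norm_bound_integral)
    show "(\<lambda>s. ?y * f (squeeze s p)) integrable_on {0..1}"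
      by (intro integrable_continuous_interval continuous_intros continuous_on_compose2[OF cont]) auto
    show "(\<lambda>s. C * (\<bar>?y\<bar> / (1 + (\<bar>?y\<bar> * s)\<^sup>2))) integrable_on {0..1}"
      using int by blast
    fix s
    have "\<bar>f (squeeze s p)\<bar> \<le> C / (1 + (\<bar>?y\<bar> * s)\<^sup>2)"
      using bound[of "squeeze s p"] by (simp add: pos_le_divide_eq add_pos_nonneg power_mult_distrib mult.commute)
    then show "norm (?y * f (squeeze s p)) \<le> C * (\<bar>?y\<bar> / (1 + (\<bar>?y\<bar> * s)\<^sup>2))"
      using mult_left_mono[of _ _ "\<bar>?y\<bar>"] by (fastforce simp: abs_mult mult.commute)
  qed
  also have "\<dots> = C * arctan \<bar>?y\<bar>"
    using int by (simp add: integral_unique)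
  also have "\<dots> \<le> C * (pi / 2)"
    using \<open>0 \<le> C\<close> arctan_ubound[of "\<bar>?y\<bar>"] by (intro mult_left_mono) auto
  finally show ?thesis by simp
qed

text \<open>The weight is a sum of two monomials, so the seminorm bounds for the multi-index 0 and
  for the one with the single entry 2 at \<open>i\<close> add up.\<close>

lemma schwartz_weighted_bound:
  fixes f :: "real ^ 'n::finite \<Rightarrow> real"
  assumes "f \<in> schwartz"
  obtains C where "\<And>p. \<bar>fold partial_deriv is f p\<bar> * (1 + (p $ i)\<^sup>2) \<le> C"
proof -
  have "\<exists>C. \<forall>p. \<bar>(\<Prod>j\<in>UNIV. (p $ j) ^ \<alpha> j) * fold partial_deriv is f p\<bar> \<le> C" for \<alpha>
    using assms by (fastforce simp: schwartz_def bounded_iff)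
  from this[of "\<lambda>_. 0"] this[of "\<lambda>j. if j = i then 2 else 0"]
  obtain A B where "\<And>p. \<bar>fold partial_deriv is f p\<bar> \<le> A"
    and "\<And>p. \<bar>(p $ i)\<^sup>2 * fold partial_deriv is f p\<bar> \<le> B"
    by (auto simp: if_distrib[of "power _"] prod.delta cong: if_cong)
  then have "\<bar>fold partial_deriv is f p\<bar> * (1 + (p $ i)\<^sup>2) \<le> A + B" for p
    by (simp add: distrib_left abs_mult mult.commute add_mono)
  then show ?thesis by (rule that)
qed

theorem proposition2p2:
  fixes h :: "real ^ 2 \<Rightarrow> real"
  assumes "h \<in> schwartz"
  shows "\<exists>u :: real ^ 2 \<Rightarrow> real ^ 2.
           C_k 1 u \<and>
           (\<forall>p. det (jacobian u (at p)) = h p) \<and>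
           (\<lambda>p. jacobian u (at p)) \<in> L_infinity"
proof -
  have h: "C_k 1 h" using assms unfolding schwartz_def by blast
  define w where "w = vertical_integral (partial_deriv 1 h)"
  have w_cont: "continuous_on UNIV w"
    unfolding w_def by (intro vertical_integral_continuous C_1_D h)
  obtain C where C: "\<And>p. \<bar>h p\<bar> \<le> C"
  proof -
    obtain C where C: "\<And>p. \<bar>fold partial_deriv [] h p\<bar> * (1 + (p $ 1)\<^sup>2) \<le> C"
      using schwartz_weighted_bound[OF assms] by blast
    \<comment> \<open>The empty list stands for \<open>h\<close> itself, and the weight is at least
      1.\<close>
    have "\<bar>h p\<bar> \<le> C" for p
      by (rule order_trans[OF _ C[of p]]) (simp add: distrib_left)
    then show ?thesis by (rule that)
  qed
  obtain D where D: "\<And>p. \<bar>w p\<bar> \<le> D"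
  proof -
    \<comment> \<open>The derivative is taken in x, but the decay is needed in y, the direction of
      integration.\<close>
    obtain D where "\<And>p. \<bar>fold partial_deriv [1] h p\<bar> * (1 + (p $ 2)\<^sup>2) \<le> D"
      using schwartz_weighted_bound[OF assms] by blast
    then have "\<bar>w p\<bar> \<le> D * pi / 2" for p
      unfolding w_def by (intro vertical_integral_bounded C_1_D h) auto
    then show ?thesis by (rule that)
  qed
  define u :: "real ^ 2 \<Rightarrow> real ^ 2" where
    "u p = (p $ 1) *\<^sub>R axis 1 1 + vertical_integral h p *\<^sub>R axis 2 1" for p
  \<comment> \<open>This is the linear map with matrix rows (1, 0) and (w, h).\<close>
  define u' :: "real ^ 2 \<Rightarrow> real ^ 2 \<Rightarrow> real ^ 2" where
    "u' p v = (v $ 1) *\<^sub>R axis 1 1 + (v $ 1 * w p + v $ 2 * h p) *\<^sub>R axis 2 1" for p v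
  have u': "(u has_derivative u' p) (at p)" for p
    unfolding u_def[abs_def] u'_def[abs_def] w_def
    by (auto intro!: derivative_eq_intros vertical_integral_has_derivative[OF h])
  have fd: "frechet_derivative u (at p) = u' p" for p
    using frechet_derivative_at[OF u'] by simp
  have u'_cont: "continuous_on UNIV (\<lambda>p. u' p v)" for v
    unfolding u'_def by (intro continuous_intros w_cont C_1_continuous[OF h])
  have jac: "jacobian u (at p) = (\<chi> i j. u' p (axis j 1) $ i)" for p
    by (simp add: jacobian_def matrix_def fd)
  have "C_k 1 u"
    using u' u'_cont by (auto simp: differentiable_on_def differentiable_def partial_deriv_def fd)
  moreover have "det (jacobian u (at p)) = h p" for p
    by (simp add: jac det_2 u'_def axis_def)
  moreover have "(\<lambda>p. jacobian u (at p)) \<in> L_infinity"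
  proof -
    have "continuous_on UNIV (\<lambda>p. jacobian u (at p))"
      unfolding jac by (intro continuous_intros u'_cont)
    then have "(\<lambda>p. jacobian u (at p)) \<in> borel_measurable lebesgue"
      by (simp add: borel_measurable_continuous_onI measurable_completion)
    moreover have "norm (jacobian u (at p)) \<le> 1 + D + C" for p
    proof -
      \<comment> \<open>The matrix norm is the Euclidean norm of the Euclidean norms of the rows;
        bounding l2 by l1 at both levels leaves the sum of the absolute entries.\<close>
      have "norm (jacobian u (at p)) \<le> (\<Sum>i\<in>UNIV. \<Sum>j\<in>UNIV. \<bar>jacobian u (at p) $ i $ j\<bar>)"
        unfolding norm_vec_def
        by (intro order_trans[OF L2_set_le_sum] sum_mono) (auto simp: norm_vec_def L2_set_le_sum_abs)
      also have "\<dots> = 1 + \<bar>w p\<bar> + \<bar>h p\<bar>"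
        by (simp add: jac sum_2 u'_def axis_def)
      finally show ?thesis using C[of p] D[of p] by linarith
    qed
    ultimately show ?thesis unfolding L_infinity_def by auto
  qed
  ultimately show ?thesis by blast
qed

end
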